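(* For all integers $r,k\geq 2$, $$g\left(n,2kr,\binom{2kr}{2}-(r-1)2k+1\right)=\Omega\left(n^{\frac{r}{r-1}\cdot\frac{k-1}{k}}\right).$$
   Context: For positive integers $n,p$ and $2\leq q\leq\binom{p}{2}$, the Erdős–Gyárfás function $g(n,p,q)$ is the smallest number $c$ such that there is a (not necessarily proper) colouring of the edges of $K_n$ with $c$ colours in which every set of $p$ vertices induces a subgraph whose edges receive at least $q$ distinct colours. *)

theory Defs
  imports Complex_Main "HOL-Library.Landau_Symbols"
begin

definition edges_of :: "nat set \<Rightarrow> nat set set" where
  "edges_of V = {e. e \<subseteq> V \<and> card e = 2}"

definition good_colouring :: "nat \<Rightarrow> nat \<Rightarrow> nat \<Rightarrow> nat \<Rightarrow> (nat set \<Rightarrow> nat) \<Rightarrow> bool" where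
  "good_colouring n p q c col \<longleftrightarrow>
     col ` edges_of {..<n} \<subseteq> {..<c} \<and>
     (\<forall>S. S \<subseteq> {..<n} \<and> card S = p \<longrightarrow> card (col ` edges_of S) \<ge> q)"

definition erdos_gyarfas :: "nat \<Rightarrow> nat \<Rightarrow> nat \<Rightarrow> nat" where
  "erdos_gyarfas n p q = (LEAST c. \<exists>col. good_colouring n p q c col)"

end

theory Submission
  imports Defs "HOL-Analysis.Convex"
begin

text \<open>
  A vertex has boundedly many incident edges of each colour, since a large monochromatic star
  wastes too many colours. In the \<^emph>\<open>energy graph\<close>, whose vertices are the injective
  \<open>r\<close>-tuples of vertices and in which two tuples are adjacent when all \<open>r\<close> coordinate pairs
  have the same colour, a cycle of length \<open>2k\<close> through pairwise disjoint tuples spans \<open>2kr\<close>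
  vertices and saves \<open>(r - 1) 2k\<close> colours, so there is none. By convexity the energy graph has
  about \<open>n\<^sup>2\<^sup>r / c\<^sup>r\<^sup>-\<^sup>1\<close> edges on \<open>n\<^sup>r\<close> vertices, and it remains to see that a graph on \<open>N\<close>
  vertices with minimum degree well above \<open>N\<^sup>1\<^sup>/\<^sup>k\<close> has a closed \<open>2k\<close>-walk without conflicts, for
  any conflict relation such that each vertex has boundedly many neighbours in conflict with a
  given vertex.

  For the latter, following Janzer's argument for rainbow cycles, closed walks are counted with
  weights: let \<open>M\<close> be the adjacency matrix normalised by the degrees and \<open>W\<^sub>m\<close> the trace of
  \<open>M\<^sup>2\<^sup>m\<close>. The walks with a conflict between two given positions have weight at most
  \<open>\<epsilon> W\<^sub>k + s / (\<epsilon> \<delta>) W\<^sub>k\<^sub>-\<^sub>1\<close>, while log-convexity, \<open>W\<^sub>0 = N\<close> and \<open>W\<^sub>k \<ge> 1\<close> give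
  \<open>W\<^sub>k\<^sub>-\<^sub>1 \<le> N\<^sup>1\<^sup>/\<^sup>k W\<^sub>k\<close>. Normalising by the degrees makes any bound on the maximum degree
  unnecessary.
\<close>

lemma sum_rotate:
  "(\<Sum>x\<in>A. \<Sum>y\<in>B. \<Sum>z\<in>C. f x y z) = (\<Sum>z\<in>C. \<Sum>x\<in>A. \<Sum>y\<in>B. f x y z)"
proof -
  have "(\<Sum>x\<in>A. \<Sum>y\<in>B. \<Sum>z\<in>C. f x y z) = (\<Sum>x\<in>A. \<Sum>z\<in>C. \<Sum>y\<in>B. f x y z)"
    by (intro sum.cong refl sum.swap)
  also have "\<dots> = (\<Sum>z\<in>C. \<Sum>x\<in>A. \<Sum>y\<in>B. f x y z)"
    by (rule sum.swap)
  finally show ?thesis .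
qed

subsection \<open>Closed walks without conflicts\<close>

locale min_degree_graph =
  fixes V :: "'a set" and adj :: "'a \<Rightarrow> 'a \<Rightarrow> bool" and \<delta> :: real
  assumes finite_V: "finite V" and V_nonempty: "V \<noteq> {}"
    and adj_sym: "adj x y \<Longrightarrow> adj y x"
    and \<delta>_pos: "\<delta> > 0"
    and min_degree: "x \<in> V \<Longrightarrow> \<delta> \<le> real (card {y \<in> V. adj x y})"
begin

section \<open>The normalised adjacency matrix and the traces of its powers\<close>

definition deg :: "'a \<Rightarrow> real" where
  "deg x = real (card {y \<in> V. adj x y})"

text \<open>The random walk matrix in symmetric form: the degree is split between both ends, so that
  traces of even powers are sums of squares.\<close>

definition M :: "'a \<Rightarrow> 'a \<Rightarrow> real" where
  "M x y = (if adj x y then 1 / (sqrt (deg x) * sqrt (deg y)) else 0)"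

primrec walk :: "nat \<Rightarrow> 'a \<Rightarrow> 'a \<Rightarrow> real" where
  "walk 0 x y = (if x = y then 1 else 0)"
| "walk (Suc m) x y = (\<Sum>z\<in>V. M x z * walk m z y)"

text \<open>The squared Frobenius norm of the \<open>m\<close>-th power of \<open>M\<close>, which
  by symmetry is the trace of the \<open>2 * m\<close>-th power. The form as a sum of squares suits
  Cauchy-Schwarz.\<close>

definition W :: "nat \<Rightarrow> real" where
  "W m = (\<Sum>x\<in>V. \<Sum>y\<in>V. (walk m x y)\<^sup>2)"

lemma deg_nonneg: "deg x \<ge> 0"
  by (simp add: deg_def)

lemma deg_ge: "x \<in> V \<Longrightarrow> \<delta> \<le> deg x"
  using min_degree by (simp add: deg_def)

lemma deg_pos: "x \<in> V \<Longrightarrow> deg x > 0"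
  using deg_ge \<delta>_pos by fastforce

lemma M_nonneg: "M x y \<ge> 0"
  by (simp add: M_def deg_nonneg)

lemma M_sym: "M x y = M y x"
  using adj_sym by (auto simp: M_def mult.commute)

lemma walk_nonneg: "walk m x y \<ge> 0"
  by (induction m arbitrary: x) (auto intro!: sum_nonneg mult_nonneg_nonneg M_nonneg)

lemma walk_one: "y \<in> V \<Longrightarrow> walk (Suc 0) x y = M x y"
  using finite_V by (simp add: if_distrib [of "\<lambda>c. _ * c"] cong: if_cong)

lemma walk_add:
  assumes "x \<in> V"
  shows "walk (a + b) x y = (\<Sum>z\<in>V. walk a x z * walk b z y)"
  using assms
proof (induction a arbitrary: x)
  case 0
  then show ?case using finite_V by (simp add: if_distrib [of "\<lambda>c. c * _"] cong: if_cong)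
next
  case (Suc a)
  have "walk (Suc a + b) x y = (\<Sum>w\<in>V. M x w * (\<Sum>z\<in>V. walk a w z * walk b z y))"
    using Suc.IH by simp
  also have "\<dots> = (\<Sum>w\<in>V. \<Sum>z\<in>V. M x w * walk a w z * walk b z y)"
    by (simp add: sum_distrib_left mult.assoc)
  also have "\<dots> = (\<Sum>z\<in>V. \<Sum>w\<in>V. M x w * walk a w z * walk b z y)"
    by (rule sum.swap)
  finally show ?case by (simp add: sum_distrib_right)
qed

lemma walk_sym: "x \<in> V \<Longrightarrow> y \<in> V \<Longrightarrow> walk m x y = walk m y x"
proof (induction m arbitrary: x y)
  case 0
  then show ?case by auto
next
  case (Suc m)
  have "walk (Suc m) x y = (\<Sum>z\<in>V. walk m y z * walk (Suc 0) z x)"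
    using Suc by (auto simp: walk_one M_sym[of x] mult.commute simp del: walk.simps(2)
        simp add: walk.simps(2)[of m] intro!: sum.cong)
  also have "\<dots> = walk (m + Suc 0) y x"
    using walk_add[OF Suc.prems(2)] by metis
  finally show ?case by simp
qed

lemma trace_walk_add:
  "(\<Sum>x\<in>V. \<Sum>y\<in>V. walk a x y * walk b x y) = (\<Sum>x\<in>V. walk (a + b) x x)"
proof -
  have "(\<Sum>y\<in>V. walk a x y * walk b x y) = walk (a + b) x x" if "x \<in> V" for x
    unfolding walk_add[OF that] using that by (intro sum.cong) (auto simp: walk_sym)
  then show ?thesis by simp
qed

lemma W_eq_trace: "W m = (\<Sum>x\<in>V. walk (m + m) x x)"
  unfolding W_def trace_walk_add[symmetric] by (simp add: power2_eq_square)

text \<open>Cauchy-Schwarz for the entries of the powers \<open>m\<close> and \<open>m + 2\<close>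
  of \<open>M\<close>: their inner product is the trace of the power \<open>2 * m + 2\<close>, that
  is, \<open>W (Suc m)\<close>.\<close>

lemma W_log_convex: "(W (Suc m))\<^sup>2 \<le> W m * W (Suc (Suc m))"
proof -
  have "W (Suc m) = (\<Sum>x\<in>V. \<Sum>y\<in>V. walk m x y * walk (Suc (Suc m)) x y)"
    unfolding W_eq_trace trace_walk_add by simp
  also have "\<dots> = (\<Sum>p\<in>V\<times>V. walk m (fst p) (snd p) * walk (Suc (Suc m)) (fst p) (snd p))"
    unfolding sum.cartesian_product by (simp add: case_prod_beta del: walk.simps)
  finally have "(W (Suc m))\<^sup>2 \<le> (\<Sum>p\<in>V\<times>V. (walk m (fst p) (snd p))\<^sup>2) *
      (\<Sum>p\<in>V\<times>V. (walk (Suc (Suc m)) (fst p) (snd p))\<^sup>2)"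
    by (simp only: Cauchy_Schwarz_ineq_sum)
  then show ?thesis
    unfolding W_def sum.cartesian_product by (simp add: case_prod_beta del: walk.simps)
qed

lemma W_0: "W 0 = real (card V)"
  unfolding W_eq_trace by simp

text \<open>The square roots of the degrees form a fixed vector of \<open>M\<close>, hence of all
  its powers.\<close>

lemma walk_sqrt_deg: "x \<in> V \<Longrightarrow> (\<Sum>y\<in>V. walk m x y * sqrt (deg y)) = sqrt (deg x)"
proof (induction m arbitrary: x)
  case 0
  then show ?case using finite_V by (simp add: if_distrib [of "\<lambda>c. c * _"] cong: if_cong)
next
  case (Suc m)
  have "(\<Sum>y\<in>V. walk (Suc m) x y * sqrt (deg y))
      = (\<Sum>y\<in>V. \<Sum>z\<in>V. M x z * (walk m z y * sqrt (deg y)))"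
    by (simp add: sum_distrib_right mult.assoc)
  also have "\<dots> = (\<Sum>z\<in>V. M x z * (\<Sum>y\<in>V. walk m z y * sqrt (deg y)))"
    by (subst sum.swap) (simp add: sum_distrib_left)
  also have "\<dots> = (\<Sum>z\<in>V. M x z * sqrt (deg z))"
    using Suc.IH by simp
  \<comment> \<open>The factor \<open>sqrt (deg z)\<close> cancels, leaving \<open>deg x\<close>
    equal terms.\<close>
  also have "\<dots> = (\<Sum>z\<in>V. if adj x z then 1 / sqrt (deg x) else 0)"
    by (intro sum.cong refl) (use deg_pos in \<open>force simp: M_def\<close>)
  also have "\<dots> = deg x / sqrt (deg x)"
    using finite_V by (simp add: sum.If_cases deg_def Int_def)
  also have "\<dots> = sqrt (deg x)"
    using deg_nonneg real_div_sqrt by blast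
  finally show ?case .
qed

text \<open>The quadratic form of the \<open>m\<close>-th power at the fixed vector equals the
  degree sum \<open>?T\<close>, and Cauchy-Schwarz bounds its square by
  \<open>W m * ?T\<^sup>2\<close>.\<close>

lemma W_ge_1: "W m \<ge> 1"
proof -
  let ?T = "\<Sum>x\<in>V. deg x"
  have T: "?T > 0"
    using finite_V V_nonempty deg_pos by (simp add: sum_pos)
  have "?T = (\<Sum>x\<in>V. sqrt (deg x) * (\<Sum>y\<in>V. walk m x y * sqrt (deg y)))"
    by (intro sum.cong refl) (simp add: walk_sqrt_deg deg_nonneg)
  also have "\<dots> = (\<Sum>p\<in>V\<times>V. walk m (fst p) (snd p) * (sqrt (deg (fst p)) * sqrt (deg (snd p))))"
    by (simp add: sum_distrib_left sum.cartesian_product case_prod_beta mult_ac)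
  finally have "?T\<^sup>2 \<le> (\<Sum>p\<in>V\<times>V. (walk m (fst p) (snd p))\<^sup>2) *
      (\<Sum>p\<in>V\<times>V. (sqrt (deg (fst p)) * sqrt (deg (snd p)))\<^sup>2)"
    by (simp only: Cauchy_Schwarz_ineq_sum)
  also have "(\<Sum>p\<in>V\<times>V. (walk m (fst p) (snd p))\<^sup>2) = W m"
    unfolding W_def sum.cartesian_product by (simp add: case_prod_beta)
  also have "(\<Sum>p\<in>V\<times>V. (sqrt (deg (fst p)) * sqrt (deg (snd p)))\<^sup>2) = ?T\<^sup>2"
    by (simp add: power_mult_distrib deg_nonneg power2_eq_square[of ?T] sum_product
        sum.cartesian_product case_prod_beta)
  finally show ?thesis using T by simp
qed

lemma W_pos: "W m > 0"
  using W_ge_1[of m] by linarith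

text \<open>By log-convexity the ratios \<open>W m / W (Suc m)\<close> do not increase with
  \<open>m\<close>, so each of the \<open>j\<close> factors is at most the true ratio at the level
  it is applied to.\<close>

lemma W_ratio_power:
  "(W m / W (Suc m)) ^ j * W (Suc m) \<le> W (Suc m - j)" if "j \<le> Suc m"
  using that
proof (induction j arbitrary: m)
  case 0
  then show ?case by simp
next
  case (Suc j)
  show ?case
  proof (cases m)
    case 0
    then show ?thesis using Suc W_pos[of "Suc 0"] by simp
  next
    case (Suc l)
    have *: "W m / W (Suc m) \<le> W l / W m"
      using W_log_convex[of l] W_pos Suc by (simp add: divide_simps power2_eq_square mult.commute)
    have "(W m / W (Suc m)) ^ Suc j * W (Suc m) = (W m / W (Suc m)) ^ j * W m"
      using W_pos[of "Suc m"] by simp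
    also have "\<dots> \<le> (W l / W m) ^ j * W m"
      using * W_pos[of m] W_pos[of "Suc m"] by (intro mult_right_mono power_mono) auto
    also have "\<dots> \<le> W (m - j)"
      using Suc.IH[of l] Suc.prems Suc by simp
    finally show ?thesis by simp
  qed
qed

text \<open>Descending \<open>Suc m\<close> levels ends at \<open>W 0\<close>, the number of
  vertices, and \<open>W (Suc m) \<ge> 1\<close> removes the remaining factor. In root form:
  \<open>W m\<close> is at most the \<open>Suc m\<close>-th root of \<open>card V\<close> times
  \<open>W (Suc m)\<close>.\<close>

lemma W_ratio: "W m ^ Suc m \<le> real (card V) * W (Suc m) ^ Suc m"
proof -
  let ?\<rho> = "W m / W (Suc m)"
  have "?\<rho> ^ Suc m * 1 \<le> ?\<rho> ^ Suc m * W (Suc m)"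
    using W_ge_1[of "Suc m"] W_pos[of m] W_pos[of "Suc m"] by (intro mult_left_mono) auto
  also have "\<dots> \<le> real (card V)"
    using W_ratio_power[of "Suc m" m] by (simp add: W_0)
  finally show ?thesis
    using W_pos[of "Suc m"] by (simp add: power_divide pos_divide_le_eq del: power_Suc)
qed

section \<open>Walks as lists of vertices\<close>

definition lists_of :: "nat \<Rightarrow> 'a list set" where
  "lists_of n = {xs. set xs \<subseteq> V \<and> length xs = n}"

lemma sum_lists_0: "(\<Sum>xs\<in>lists_of 0. g xs) = g []"
proof -
  have "lists_of 0 = {[]}" by (auto simp: lists_of_def)
  then show ?thesis by simp
qed

lemma sum_lists_Suc: "(\<Sum>xs\<in>lists_of (Suc n). g xs) = (\<Sum>x\<in>V. \<Sum>xs\<in>lists_of n. g (x # xs))"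
proof -
  have eq: "lists_of (Suc n) = (\<lambda>(x, xs). x # xs) ` (V \<times> lists_of n)"
    by (auto simp: lists_of_def image_def length_Suc_conv)
  have "inj_on (\<lambda>(x, xs). x # xs) (V \<times> lists_of n)"
    by (auto simp: inj_on_def)
  then show ?thesis
    unfolding eq sum.cartesian_product by (simp add: sum.reindex case_prod_unfold comp_def)
qed

lemma sum_lists_append:
  "(\<Sum>xs\<in>lists_of (a + b). g xs) = (\<Sum>xs\<in>lists_of a. \<Sum>ys\<in>lists_of b. g (xs @ ys))"
  by (induction a arbitrary: g) (simp_all add: sum_lists_0 sum_lists_Suc)

text \<open>The list holds the interior vertices only, so a list of length \<open>n\<close> is a
  walk of \<open>Suc n\<close> steps.\<close>

primrec path_weight :: "'a \<Rightarrow> 'a list \<Rightarrow> 'a \<Rightarrow> real" where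
  "path_weight x [] y = M x y"
| "path_weight x (z # zs) y = M x z * path_weight z zs y"

lemma path_weight_append:
  "path_weight x (xs @ z # zs) y = path_weight x xs z * path_weight z zs y"
  by (induction xs arbitrary: x) auto

lemma path_weight_nonneg: "path_weight x xs y \<ge> 0"
  by (induction xs arbitrary: x) (auto intro!: mult_nonneg_nonneg M_nonneg)

lemma path_weight_nonzeroD:
  "path_weight x xs y \<noteq> 0 \<Longrightarrow> i \<le> length xs \<Longrightarrow> adj ((x # xs) ! i) ((xs @ [y]) ! i)"
  by (induction xs arbitrary: x i)
    (auto simp: M_def nth_Cons split: nat.splits if_splits)

lemma sum_path_weight: "y \<in> V \<Longrightarrow> (\<Sum>xs\<in>lists_of n. path_weight x xs y) = walk (Suc n) x y"
proof (induction n arbitrary: x)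
  case 0
  then show ?case by (simp add: sum_lists_0 flip: walk_one)
next
  case (Suc n)
  then show ?case by (simp add: sum_lists_Suc sum_distrib_left[symmetric])
qed

text \<open>Cutting a closed walk at a vertex in conflict with its start leaves two independent
  walks.\<close>

lemma path_weight_split_one:
  assumes "x \<in> V"
  shows "(\<Sum>xs\<in>lists_of (a + Suc b). path_weight x xs x * of_bool (C x (xs ! a)))
    = (\<Sum>z\<in>V. of_bool (C x z) * (walk (Suc a) x z * walk (Suc b) z x))"
proof -
  have "(\<Sum>xs\<in>lists_of (a + Suc b). path_weight x xs x * of_bool (C x (xs ! a)))
    = (\<Sum>ys\<in>lists_of a. \<Sum>z\<in>V. \<Sum>zs\<in>lists_of b.
        path_weight x ys z * path_weight z zs x * of_bool (C x z))"
    unfolding sum_lists_append sum_lists_Suc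
    by (intro sum.cong refl) (auto simp: path_weight_append nth_append lists_of_def)
  also have "\<dots> = (\<Sum>z\<in>V. \<Sum>ys\<in>lists_of a. \<Sum>zs\<in>lists_of b.
        path_weight x ys z * path_weight z zs x * of_bool (C x z))"
    by (rule sum.swap)
  also have "\<dots> = (\<Sum>z\<in>V. of_bool (C x z) * (walk (Suc a) x z * walk (Suc b) z x))"
    by (intro sum.cong refl)
      (simp add: sum_path_weight[symmetric] assms sum_product sum_distrib_left mult_ac del: walk.simps)
  finally show ?thesis .
qed

text \<open>Both vertices in conflict are interior here, so the closed walk falls into three
  segments, the outer two of which meet at the base point \<open>x\<close>.\<close>

lemma path_weight_split_two:
  assumes "x \<in> V"
  shows "(\<Sum>xs\<in>lists_of (a + Suc (b + Suc c)).
        path_weight x xs x * of_bool (C (xs ! a) (xs ! (a + Suc b))))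
    = (\<Sum>y\<in>V. \<Sum>z\<in>V. of_bool (C y z) * walk (Suc b) y z * (walk (Suc c) z x * walk (Suc a) x y))"
proof -
  have "(\<Sum>xs\<in>lists_of (a + Suc (b + Suc c)).
        path_weight x xs x * of_bool (C (xs ! a) (xs ! (a + Suc b))))
    = (\<Sum>us\<in>lists_of a. \<Sum>y\<in>V. \<Sum>ys\<in>lists_of b. \<Sum>z\<in>V. \<Sum>zs\<in>lists_of c.
        path_weight x us y * (path_weight y ys z * path_weight z zs x) * of_bool (C y z))"
    unfolding sum_lists_append sum_lists_Suc
    by (intro sum.cong refl) (auto simp: path_weight_append nth_append lists_of_def)
  also have "\<dots> = (\<Sum>y\<in>V. \<Sum>us\<in>lists_of a. \<Sum>z\<in>V. \<Sum>ys\<in>lists_of b. \<Sum>zs\<in>lists_of c.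
        path_weight x us y * (path_weight y ys z * path_weight z zs x) * of_bool (C y z))"
    by (subst sum.swap) (intro sum.cong refl sum.swap)
  also have "\<dots> = (\<Sum>y\<in>V. \<Sum>z\<in>V. \<Sum>us\<in>lists_of a. \<Sum>ys\<in>lists_of b. \<Sum>zs\<in>lists_of c.
        path_weight x us y * (path_weight y ys z * path_weight z zs x) * of_bool (C y z))"
    by (intro sum.cong refl sum.swap)
  also have "\<dots> = (\<Sum>y\<in>V. \<Sum>z\<in>V.
      of_bool (C y z) * walk (Suc b) y z * (walk (Suc c) z x * walk (Suc a) x y))"
  proof (intro sum.cong refl)
    fix y z assume "y \<in> V" "z \<in> V"
    have "(\<Sum>us\<in>lists_of a. \<Sum>ys\<in>lists_of b. \<Sum>zs\<in>lists_of c.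
        path_weight x us y * (path_weight y ys z * path_weight z zs x) * of_bool (C y z))
      = (\<Sum>us\<in>lists_of a. path_weight x us y * (\<Sum>ys\<in>lists_of b. path_weight y ys z *
          (\<Sum>zs\<in>lists_of c. path_weight z zs x))) * of_bool (C y z)"
      by (simp add: sum_distrib_left sum_distrib_right mult_ac)
    also have "\<dots> = walk (Suc a) x y * (walk (Suc b) y z * walk (Suc c) z x) * of_bool (C y z)"
      using \<open>y \<in> V\<close> \<open>z \<in> V\<close> assms
      by (simp only: sum_path_weight sum_distrib_right[symmetric])
    finally show "(\<Sum>us\<in>lists_of a. \<Sum>ys\<in>lists_of b. \<Sum>zs\<in>lists_of c.
        path_weight x us y * (path_weight y ys z * path_weight z zs x) * of_bool (C y z))
      = of_bool (C y z) * walk (Suc b) y z * (walk (Suc c) z x * walk (Suc a) x y)"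
      by (simp add: mult_ac del: walk.simps)
  qed
  finally show ?thesis .
qed

section \<open>The weight of closed walks with a conflict\<close>

text \<open>Closed walks of length \<open>l + m\<close> with two marked vertices in conflict, cut at
  these into arcs of lengths \<open>l\<close> and \<open>m\<close>.\<close>

definition conflict_weight :: "('a \<Rightarrow> 'a \<Rightarrow> bool) \<Rightarrow> nat \<Rightarrow> nat \<Rightarrow> real" where
  "conflict_weight C l m = (\<Sum>y\<in>V. \<Sum>z\<in>V. of_bool (C y z) * (walk l y z * walk m z y))"

text \<open>Only the distance between the two positions matters, as a closed walk can be rotated:
  for \<open>i > 0\<close> summing over the base point joins the two outer segments into one
  arc.\<close>

lemma sum_path_weight_conflict:
  assumes "i < j" "j < n"
  shows "(\<Sum>x\<in>V. \<Sum>xs\<in>lists_of (n - 1).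
      path_weight x xs x * of_bool (C ((x # xs) ! i) ((x # xs) ! j)))
    = conflict_weight C (j - i) (n - (j - i))"
proof (cases i)
  case 0
  define a b where "a = j - 1" and "b = n - j - 1"
  have "j = Suc a" "n = Suc (a + Suc b)"
    using assms unfolding a_def b_def by auto
  then show ?thesis
    using 0 path_weight_split_one by (simp add: conflict_weight_def del: walk.simps)
next
  case (Suc a)
  define b c where "b = j - i - 1" and "c = n - j - 1"
  have j: "j = Suc (a + Suc b)" and n: "n = Suc (a + Suc (b + Suc c))"
    using assms Suc unfolding b_def c_def by auto
  have "(\<Sum>x\<in>V. \<Sum>xs\<in>lists_of (n - 1).
      path_weight x xs x * of_bool (C ((x # xs) ! i) ((x # xs) ! j)))
    = (\<Sum>x\<in>V. \<Sum>y\<in>V. \<Sum>z\<in>V.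
        of_bool (C y z) * walk (Suc b) y z * (walk (Suc c) z x * walk (Suc a) x y))"
    unfolding j n Suc using path_weight_split_two by simp
  also have "\<dots> = (\<Sum>y\<in>V. \<Sum>x\<in>V. \<Sum>z\<in>V.
        of_bool (C y z) * walk (Suc b) y z * (walk (Suc c) z x * walk (Suc a) x y))"
    by (rule sum.swap)
  also have "\<dots> = (\<Sum>y\<in>V. \<Sum>z\<in>V. \<Sum>x\<in>V.
        of_bool (C y z) * walk (Suc b) y z * (walk (Suc c) z x * walk (Suc a) x y))"
    by (intro sum.cong refl sum.swap)
  also have "\<dots> = (\<Sum>y\<in>V. \<Sum>z\<in>V.
        of_bool (C y z) * walk (Suc b) y z * walk (Suc c + Suc a) z y)"
    by (intro sum.cong refl) (simp only: walk_add sum_distrib_left[symmetric])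
  finally show ?thesis
    by (simp add: conflict_weight_def j n Suc mult.assoc add.commute del: walk.simps)
qed

lemma conflict_weight_commute:
  assumes "\<And>x y. C x y \<Longrightarrow> C y x"
  shows "conflict_weight C l m = conflict_weight C m l"
proof -
  have "conflict_weight C l m = (\<Sum>z\<in>V. \<Sum>y\<in>V. of_bool (C y z) * (walk l y z * walk m z y))"
    unfolding conflict_weight_def by (rule sum.swap)
  moreover have "C y z = C z y" for y z
    using assms by blast
  ultimately show ?thesis
    unfolding conflict_weight_def by (simp add: mult.commute)
qed

text \<open>The summands are the squared entries of a row of \<open>M\<close>: \<open>deg x\<close>
  of them are nonzero, each at most \<open>1 / (deg x * \<delta>)\<close>.\<close>

lemma M_row_bound:
  assumes "x \<in> V"
  shows "(\<Sum>y\<in>V. of_bool (adj x y) / (deg x * deg y)) \<le> 1 / \<delta>"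
proof -
  have "(\<Sum>y\<in>V. of_bool (adj x y) / (deg x * deg y)) \<le> (\<Sum>y\<in>V. of_bool (adj x y) * (1 / (deg x * \<delta>)))"
    using deg_pos[OF assms] deg_ge \<delta>_pos deg_pos
    by (intro sum_mono) (auto simp: divide_simps)
  also have "\<dots> = deg x * (1 / (deg x * \<delta>))"
  proof -
    have "(\<Sum>y\<in>V. of_bool (adj x y)) = deg x"
      using finite_V by (simp add: deg_def Int_def)
    then show ?thesis by (simp only: sum_distrib_right[symmetric])
  qed
  finally show ?thesis
    using deg_pos[OF assms] by simp
qed

text \<open>Closed walks of length \<open>2 * k + 2\<close> are cut at \<open>u\<close>, at its
  successor \<open>x\<close>, at \<open>z\<close> after \<open>l\<close> further steps, and at
  \<open>v\<close>, which comes \<open>k + 1\<close> steps after \<open>x\<close>. The product of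
  \<open>M u x\<close> and \<open>walk k u v\<close> is compared with
  \<open>walk (Suc k) x v\<close>; small products give the first term, large ones the
  second.\<close>

lemma conflict_weight_bound:
  assumes s: "\<And>x y. x \<in> V \<Longrightarrow> y \<in> V \<Longrightarrow> real (card {w \<in> V. adj y w \<and> C w x}) \<le> s"
    and "s > 0" "\<epsilon> > 0" and l: "l \<le> k"
  shows "conflict_weight C (Suc l) (2 * k + 1 - l) \<le> \<epsilon> * W (Suc k) + s / (\<epsilon> * \<delta>) * W k"
proof -
  \<comment> \<open>The part of the step weight where \<open>walk k u v\<close> is large compared to \<open>walk (Suc k) x v\<close>. In the
    remaining part \<open>u\<close> is one of at most \<open>s\<close> neighbours of \<open>x\<close> in conflict with \<open>z\<close>; in this part the
    conflict is ignored and only a closed walk of length \<open>2 * k\<close> through \<open>u\<close> and \<open>v\<close> is left.\<close>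
  define Q where "Q = (\<lambda>u x v. if s * (M u x * walk k u v) \<le> \<epsilon> * walk (Suc k) x v then 0
      else M u x * walk k u v)"
  define P where "P = (\<lambda>x z v. walk l x z * walk (Suc k - l) z v)"
  have P: "P x z v \<ge> 0" for x z v
    by (simp add: P_def walk_nonneg del: walk.simps)
  have sum_P: "(\<Sum>z\<in>V. P x z v) = walk (Suc k) x v" if "x \<in> V" for x v
    using walk_add[OF that, of l "Suc k - l" v] l by (simp add: P_def del: walk.simps)
  have split: "of_bool (C u z) * (M u x * walk k u v)
      \<le> \<epsilon> / s * of_bool (adj x u \<and> C u z) * walk (Suc k) x v + Q u x v" for u x z v
  proof (cases "adj u x \<and> C u z \<and> s * (M u x * walk k u v) \<le> \<epsilon> * walk (Suc k) x v")
    case True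
    then show ?thesis
      using \<open>s > 0\<close> adj_sym[of u x] by (simp add: Q_def field_simps del: walk.simps)
  next
    case False
    have "0 \<le> \<epsilon> / s * of_bool (adj x u \<and> C u z) * walk (Suc k) x v"
      using \<open>s > 0\<close> \<open>\<epsilon> > 0\<close> by (intro mult_nonneg_nonneg walk_nonneg) auto
    moreover have "of_bool (C u z) * (M u x * walk k u v) \<le> Q u x v"
      using False mult_nonneg_nonneg[OF M_nonneg[of u x] walk_nonneg[of k u v]]
      by (auto simp: Q_def M_def[of u x])
    ultimately show ?thesis by linarith
  qed
  \<comment> \<open>Where \<open>Q\<close> is nonzero, \<open>walk (Suc k) x v\<close> is at most
    \<open>s / \<epsilon>\<close> times \<open>Q u x v\<close>, which turns the product into a
    square.\<close>
  have Q: "Q u x v * walk (Suc k) x v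
      \<le> s / \<epsilon> * (of_bool (adj u x) / (deg u * deg x)) * (walk k u v)\<^sup>2"
    if "u \<in> V" "x \<in> V" for u x v
  proof (cases "Q u x v = 0")
    case True
    then show ?thesis
      using \<open>s > 0\<close> \<open>\<epsilon> > 0\<close> by (auto simp: deg_nonneg)
  next
    case False
    then have "\<epsilon> * walk (Suc k) x v \<le> s * (M u x * walk k u v)" and eq: "Q u x v = M u x * walk k u v"
      by (auto simp: Q_def split: if_splits)
    then have "walk (Suc k) x v \<le> s / \<epsilon> * (M u x * walk k u v)"
      using \<open>\<epsilon> > 0\<close> by (simp add: field_simps del: walk.simps)
    then have "Q u x v * walk (Suc k) x v \<le> (M u x * walk k u v) * (s / \<epsilon> * (M u x * walk k u v))"
      unfolding eq by (intro mult_left_mono mult_nonneg_nonneg M_nonneg walk_nonneg)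
    also have "\<dots> = s / \<epsilon> * (M u x)\<^sup>2 * (walk k u v)\<^sup>2"
      by (simp add: power2_eq_square)
    also have "(M u x)\<^sup>2 = of_bool (adj u x) / (deg u * deg x)"
      by (simp add: M_def power_divide power_mult_distrib deg_nonneg)
    finally show ?thesis .
  qed
  have "conflict_weight C (Suc l) (2 * k + 1 - l)
     = (\<Sum>u\<in>V. \<Sum>z\<in>V. \<Sum>x\<in>V. \<Sum>v\<in>V. P x z v * (of_bool (C u z) * (M u x * walk k u v)))"
  proof -
    have eq: "2 * k + 1 - l = (Suc k - l) + k" using l by simp
    have "walk (Suc l) u z * walk (Suc k - l + k) z u
        = (\<Sum>x\<in>V. \<Sum>v\<in>V. P x z v * (M u x * walk k u v))" if "u \<in> V" "z \<in> V" for u z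
    proof -
      have "walk (Suc l) u z * walk (Suc k - l + k) z u
          = (\<Sum>x\<in>V. M u x * walk l x z) * (\<Sum>v\<in>V. walk (Suc k - l) z v * walk k u v)"
        using that walk_add[OF that(2), of "Suc k - l" k u] walk_sym[of _ u k]
        by (simp del: walk.simps add: walk.simps(2)[of l])
      then show ?thesis
        by (simp add: P_def sum_product mult_ac del: walk.simps)
    qed
    then show ?thesis
      unfolding conflict_weight_def eq
      by (intro sum.cong refl) (simp add: sum_distrib_left mult_ac del: walk.simps)
  qed
  also have "\<dots> \<le> (\<Sum>u\<in>V. \<Sum>z\<in>V. \<Sum>x\<in>V. \<Sum>v\<in>V. P x z v *
      (\<epsilon> / s * of_bool (adj x u \<and> C u z) * walk (Suc k) x v + Q u x v))"
    by (intro sum_mono mult_left_mono split P)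
  also have "\<dots> = (\<Sum>u\<in>V. \<Sum>z\<in>V. \<Sum>x\<in>V. \<Sum>v\<in>V. P x z v *
      (\<epsilon> / s * of_bool (adj x u \<and> C u z) * walk (Suc k) x v))
    + (\<Sum>u\<in>V. \<Sum>z\<in>V. \<Sum>x\<in>V. \<Sum>v\<in>V. P x z v * Q u x v)"
    by (simp add: distrib_left sum.distrib del: walk.simps)
  also have "(\<Sum>u\<in>V. \<Sum>z\<in>V. \<Sum>x\<in>V. \<Sum>v\<in>V. P x z v *
      (\<epsilon> / s * of_bool (adj x u \<and> C u z) * walk (Suc k) x v)) \<le> \<epsilon> * W (Suc k)"
  proof -
    have "(\<Sum>u\<in>V. \<Sum>z\<in>V. \<Sum>x\<in>V. \<Sum>v\<in>V. P x z v *
        (\<epsilon> / s * of_bool (adj x u \<and> C u z) * walk (Suc k) x v))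
      = (\<Sum>z\<in>V. \<Sum>u\<in>V. \<Sum>x\<in>V. \<Sum>v\<in>V. P x z v *
        (\<epsilon> / s * of_bool (adj x u \<and> C u z) * walk (Suc k) x v))"
      by (rule sum.swap)
    also have "\<dots> = (\<Sum>z\<in>V. \<Sum>x\<in>V. \<Sum>u\<in>V. \<Sum>v\<in>V. P x z v *
        (\<epsilon> / s * of_bool (adj x u \<and> C u z) * walk (Suc k) x v))"
      by (intro sum.cong refl sum.swap)
    also have "\<dots> = (\<Sum>z\<in>V. \<Sum>x\<in>V. (\<Sum>u\<in>V. of_bool (adj x u \<and> C u z)) *
        (\<Sum>v\<in>V. \<epsilon> / s * (P x z v * walk (Suc k) x v)))"
      by (simp add: sum_product mult_ac del: walk.simps sum_of_bool_eq)
    \<comment> \<open>At most \<open>s\<close> neighbours \<open>u\<close> of \<open>x\<close>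
      conflict with \<open>z\<close>. This cancels the factor \<open>1 / s\<close>, after which
      summing over \<open>z\<close> collapses \<open>P\<close> to
      \<open>walk (Suc k) x v\<close>.\<close>
    also have "\<dots> \<le> (\<Sum>z\<in>V. \<Sum>x\<in>V. s * (\<Sum>v\<in>V. \<epsilon> / s * (P x z v * walk (Suc k) x v)))"
    proof (intro sum_mono mult_right_mono)
      fix z x assume "z \<in> V" "x \<in> V"
      then show "(\<Sum>u\<in>V. of_bool (adj x u \<and> C u z)) \<le> s"
        using s[of z x] finite_V by (simp add: Int_def)
      show "0 \<le> (\<Sum>v\<in>V. \<epsilon> / s * (P x z v * walk (Suc k) x v))"
        using \<open>s > 0\<close> \<open>\<epsilon> > 0\<close> P
        by (intro sum_nonneg mult_nonneg_nonneg walk_nonneg) auto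
    qed
    also have "\<dots> = (\<Sum>z\<in>V. \<Sum>x\<in>V. \<Sum>v\<in>V. \<epsilon> * (P x z v * walk (Suc k) x v))"
      using \<open>s > 0\<close> by (simp add: sum_distrib_left del: walk.simps)
    also have "\<dots> = (\<Sum>x\<in>V. \<Sum>z\<in>V. \<Sum>v\<in>V. \<epsilon> * (P x z v * walk (Suc k) x v))"
      by (rule sum.swap)
    also have "\<dots> = (\<Sum>x\<in>V. \<Sum>v\<in>V. \<Sum>z\<in>V. \<epsilon> * (P x z v * walk (Suc k) x v))"
      by (intro sum.cong refl sum.swap)
    also have "\<dots> = (\<Sum>x\<in>V. \<Sum>v\<in>V. \<epsilon> * ((\<Sum>z\<in>V. P x z v) * walk (Suc k) x v))"
      by (simp add: sum_distrib_left sum_distrib_right del: walk.simps)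
    also have "\<dots> = \<epsilon> * W (Suc k)"
      by (simp add: sum_P W_def sum_distrib_left power2_eq_square del: walk.simps)
    finally show ?thesis .
  qed
  also have "(\<Sum>u\<in>V. \<Sum>z\<in>V. \<Sum>x\<in>V. \<Sum>v\<in>V. P x z v * Q u x v) \<le> s / (\<epsilon> * \<delta>) * W k"
  proof -
    have "(\<Sum>u\<in>V. \<Sum>z\<in>V. \<Sum>x\<in>V. \<Sum>v\<in>V. P x z v * Q u x v)
        = (\<Sum>u\<in>V. \<Sum>x\<in>V. \<Sum>z\<in>V. \<Sum>v\<in>V. P x z v * Q u x v)"
      by (intro sum.cong refl sum.swap)
    also have "\<dots> = (\<Sum>u\<in>V. \<Sum>x\<in>V. \<Sum>v\<in>V. \<Sum>z\<in>V. P x z v * Q u x v)"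
      by (intro sum.cong refl sum.swap)
    also have "\<dots> = (\<Sum>u\<in>V. \<Sum>x\<in>V. \<Sum>v\<in>V. Q u x v * walk (Suc k) x v)"
      by (intro sum.cong refl) (simp add: sum_P sum_distrib_right[symmetric] mult.commute del: walk.simps)
    also have "\<dots> \<le> (\<Sum>u\<in>V. \<Sum>x\<in>V. \<Sum>v\<in>V.
        s / \<epsilon> * (of_bool (adj u x) / (deg u * deg x)) * (walk k u v)\<^sup>2)"
      by (intro sum_mono Q)
    also have "\<dots> = (\<Sum>u\<in>V. s / \<epsilon> * (\<Sum>x\<in>V. of_bool (adj u x) / (deg u * deg x)) *
        (\<Sum>v\<in>V. (walk k u v)\<^sup>2))"
      by (simp only: sum_distrib_left[of "s / \<epsilon>"] sum_product)
    also have "\<dots> \<le> (\<Sum>u\<in>V. s / \<epsilon> * (1 / \<delta>) * (\<Sum>v\<in>V. (walk k u v)\<^sup>2))"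
      using \<open>s > 0\<close> \<open>\<epsilon> > 0\<close>
      by (intro sum_mono mult_right_mono mult_left_mono M_row_bound sum_nonneg) auto
    also have "\<dots> = s / (\<epsilon> * \<delta>) * W k"
      by (simp add: W_def sum_distrib_left)
    finally show ?thesis .
  qed
  finally show ?thesis by simp
qed

text \<open>If every closed \<open>2 * k\<close>-walk of positive weight had a conflict, summing the
  conflict weights over all pairs of positions would contradict \<open>large\<close>. In root form,
  \<open>large\<close> says that \<open>\<delta>\<close> exceeds \<open>64 * k ^ 4 * s\<close> times
  the \<open>k\<close>-th root of \<open>card V\<close>.\<close>

theorem conflict_free_closed_walk:
  fixes C :: "'a \<Rightarrow> 'a \<Rightarrow> bool"
  assumes C_sym: "\<And>x y. C x y \<Longrightarrow> C y x"
    and s: "\<And>x y. x \<in> V \<Longrightarrow> y \<in> V \<Longrightarrow> real (card {w \<in> V. adj y w \<and> C w x}) \<le> s"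
    and "s > 0" "k > 0"
    and large: "(64 * real k ^ 4 * s) ^ k * real (card V) < \<delta> ^ k"
  obtains x where "\<And>i. i < 2 * k \<Longrightarrow> x i \<in> V"
    and "\<And>i. i < 2 * k \<Longrightarrow> adj (x i) (x (Suc i mod (2 * k)))"
    and "\<And>i j. i < 2 * k \<Longrightarrow> j < 2 * k \<Longrightarrow> i \<noteq> j \<Longrightarrow> \<not> C (x i) (x j)"
proof -
  obtain m where k: "k = Suc m"
    using \<open>k > 0\<close> gr0_conv_Suc by blast
  define n where "n = 2 * k"
  \<comment> \<open>The number of conflicting pairs of positions; being an integer, it vanishes once
    it is below 1.\<close>
  define conf where "conf = (\<lambda>c. \<Sum>j<n. \<Sum>i<j. of_bool (C (c ! i) (c ! j)) :: real)"
  have "\<exists>x\<in>V. \<exists>xs\<in>lists_of (n - 1). path_weight x xs x \<noteq> 0 \<and> conf (x # xs) < 1"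
  proof (rule ccontr)
    assume "\<not> ?thesis"
    then have conf: "path_weight x xs x \<le> path_weight x xs x * conf (x # xs)"
      if "x \<in> V" "xs \<in> lists_of (n - 1)" for x xs
      using that path_weight_nonneg[of x xs x]
      by (cases "path_weight x xs x = 0") (auto simp: not_less mult_le_cancel_left1)
    \<comment> \<open>There are at most \<open>4 * real k ^ 2\<close> pairs of positions, so with
      this choice the \<open>W k\<close> terms add up to at most half of \<open>W k\<close>.\<close>
    define \<epsilon> :: real where "\<epsilon> = 1 / (8 * real k ^ 2)"
    define B where "B = \<epsilon> * W k + s / (\<epsilon> * \<delta>) * W m"
    have "\<epsilon> > 0"
      using \<open>k > 0\<close> by (simp add: \<epsilon>_def)
    have "B \<ge> 0"
      using \<open>\<epsilon> > 0\<close> \<open>s > 0\<close> \<delta>_pos W_pos[of k] W_pos[of m] by (simp add: B_def)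
    have half: "conflict_weight C l (n - l) \<le> B" if "0 < l" "l \<le> k" for l
      using conflict_weight_bound[where l = "l - 1" and k = m, OF s \<open>s > 0\<close> \<open>\<epsilon> > 0\<close>] that
      by (simp add: B_def k n_def mult_2)
    \<comment> \<open>An arc longer than half the walk is exchanged for the complementary
      arc.\<close>
    have bound: "conflict_weight C l (n - l) \<le> B" if "0 < l" "l < n" for l
    proof (cases "l \<le> k")
      case True
      then show ?thesis using half that by simp
    next
      case False
      then have "conflict_weight C (n - l) (n - (n - l)) \<le> B"
        using that by (intro half) (auto simp: n_def)
      then show ?thesis
        using that conflict_weight_commute[OF C_sym] by simp
    qed
    have "W k = (\<Sum>x\<in>V. \<Sum>xs\<in>lists_of (n - 1). path_weight x xs x)"
      unfolding W_eq_trace using \<open>k > 0\<close>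
      by (intro sum.cong refl) (simp add: sum_path_weight n_def mult_2 del: walk.simps)
    also have "\<dots> \<le> (\<Sum>x\<in>V. \<Sum>xs\<in>lists_of (n - 1). path_weight x xs x * conf (x # xs))"
      by (intro sum_mono conf)
    also have "\<dots> = (\<Sum>x\<in>V. \<Sum>xs\<in>lists_of (n - 1). \<Sum>j<n. \<Sum>i<j.
        path_weight x xs x * of_bool (C ((x # xs) ! i) ((x # xs) ! j)))"
      by (simp only: conf_def sum_distrib_left)
    also have "\<dots> = (\<Sum>j<n. \<Sum>x\<in>V. \<Sum>xs\<in>lists_of (n - 1). \<Sum>i<j.
        path_weight x xs x * of_bool (C ((x # xs) ! i) ((x # xs) ! j)))"
      by (rule sum_rotate)
    also have "\<dots> = (\<Sum>j<n. \<Sum>i<j. \<Sum>x\<in>V. \<Sum>xs\<in>lists_of (n - 1).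
        path_weight x xs x * of_bool (C ((x # xs) ! i) ((x # xs) ! j)))"
      by (intro sum.cong refl sum_rotate)
    also have "\<dots> = (\<Sum>j<n. \<Sum>i<j. conflict_weight C (j - i) (n - (j - i)))"
      by (intro sum.cong refl sum_path_weight_conflict) auto
    also have "\<dots> \<le> (\<Sum>j<n. \<Sum>i<n. B)"
    proof (intro sum_mono)
      fix j assume "j \<in> {..<n}"
      then have "(\<Sum>i<j. conflict_weight C (j - i) (n - (j - i))) \<le> (\<Sum>i<j. B)"
        by (intro sum_mono bound) auto
      also have "\<dots> \<le> (\<Sum>i<n. B)"
        using \<open>B \<ge> 0\<close> \<open>j \<in> {..<n}\<close> by (intro sum_mono2) auto
      finally show "(\<Sum>i<j. conflict_weight C (j - i) (n - (j - i))) \<le> (\<Sum>i<n. B)" .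
    qed
    also have "\<dots> = 4 * real k ^ 2 * B"
      by (simp add: n_def power2_eq_square)
    also have "\<dots> = W k / 2 + 32 * real k ^ 4 * s / \<delta> * W m"
      using \<open>k > 0\<close> \<delta>_pos by (simp add: B_def \<epsilon>_def field_simps eval_nat_numeral)
    finally have "\<delta> * W k \<le> 64 * real k ^ 4 * s * W m"
      using \<delta>_pos by (simp add: field_simps)
    then have "(\<delta> * W k) ^ k \<le> (64 * real k ^ 4 * s * W m) ^ k"
      using \<delta>_pos W_pos[of k] by (intro power_mono) auto
    also have "\<dots> = (64 * real k ^ 4 * s) ^ k * W m ^ k"
      by (simp add: power_mult_distrib)
    also have "\<dots> \<le> (64 * real k ^ 4 * s) ^ k * (real (card V) * W k ^ k)"
      using W_ratio[of m] \<open>s > 0\<close> unfolding k by (intro mult_left_mono) auto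
    finally have "\<delta> ^ k * W k ^ k \<le> (64 * real k ^ 4 * s) ^ k * real (card V) * W k ^ k"
      by (simp add: power_mult_distrib mult_ac)
    then show False
      using large W_pos[of k] by (simp add: mult_le_cancel_right)
  qed
  then obtain x xs where x: "x \<in> V" and xs: "xs \<in> lists_of (n - 1)"
    and walk: "path_weight x xs x \<noteq> 0" and conf: "conf (x # xs) < 1"
    by blast
  have len: "length xs = n - 1" "set xs \<subseteq> V"
    using xs by (auto simp: lists_of_def)
  have n: "n > 0" using \<open>k > 0\<close> by (simp add: n_def)
  have no_conf: "\<not> C ((x # xs) ! i) ((x # xs) ! j)" if "i < j" "j < n" for i j
  proof
    assume "C ((x # xs) ! i) ((x # xs) ! j)"
    then have "1 \<le> (\<Sum>i<j. of_bool (C ((x # xs) ! i) ((x # xs) ! j)) :: real)"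
      using that member_le_sum[of i "{..<j}" "\<lambda>i. of_bool (C ((x # xs) ! i) ((x # xs) ! j)) :: real"]
      by simp
    also have "\<dots> \<le> conf (x # xs)"
      unfolding conf_def using that
      by (intro member_le_sum[of j "{..<n}" "\<lambda>j. \<Sum>i<j. of_bool (C ((x # xs) ! i) ((x # xs) ! j)) :: real"])
        (auto intro: sum_nonneg)
    finally show False using conf by simp
  qed
  show ?thesis
  proof (rule that[of "\<lambda>i. (x # xs) ! i", folded n_def])
    fix i assume i: "i < n"
    then have "(x # xs) ! i \<in> set (x # xs)"
      using len n by (intro nth_mem) auto
    then show "(x # xs) ! i \<in> V" using x len by auto
    have "(xs @ [x]) ! i = (x # xs) ! (Suc i mod n)"
    proof (cases "Suc i = n")
      case True
      then have "i = length xs" using len by simp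
      then show ?thesis using True by (simp add: nth_append)
    next
      case False
      then have "Suc i < n" "i < length xs" using i len by auto
      then show ?thesis by (simp add: nth_append)
    qed
    then show "adj ((x # xs) ! i) ((x # xs) ! (Suc i mod n))"
      using path_weight_nonzeroD[OF walk, of i] i len by simp
  next
    fix i j assume "i < n" "j < n" "i \<noteq> j"
    then show "\<not> C ((x # xs) ! i) ((x # xs) ! j)"
      using no_conf[of i j] no_conf[of j i] C_sym by (meson nat_neq_iff)
  qed
qed

end

section \<open>Large minimum degree, power means and greedy counting\<close>

text \<open>Take \<open>S\<close> minimising \<open>t * card S\<close> minus the number of adjacent
  ordered pairs in \<open>S\<close>. The hypothesis makes the minimum negative, so \<open>S\<close>
  is nonempty. Deleting a vertex of degree below \<open>t / 2\<close> would lose fewer than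
  \<open>t\<close> ordered pairs and lower the value.\<close>

lemma min_degree_subset:
  fixes adj :: "'a \<Rightarrow> 'a \<Rightarrow> bool" and t :: real
  assumes "finite V" and sym: "\<And>x y. adj x y \<Longrightarrow> adj y x"
    and t: "t * real (card V) < real (card {(x, y). x \<in> V \<and> y \<in> V \<and> adj x y})"
  obtains S where "S \<subseteq> V" "S \<noteq> {}" "\<And>v. v \<in> S \<Longrightarrow> t / 2 \<le> real (card {y \<in> S. adj v y})"
proof -
  define E where "E = (\<lambda>S. {(x, y). x \<in> S \<and> y \<in> S \<and> adj x y})"
  define f where "f = (\<lambda>S. t * real (card S) - real (card (E S)))"
  have fin_E: "finite (E S)" if "finite S" for S
    by (rule finite_subset[of _ "S \<times> S"]) (use that in \<open>auto simp: E_def\<close>)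
  obtain S where "is_arg_min f (\<lambda>S. S \<in> Pow V) S"
    using ex_is_arg_min_if_finite[of "Pow V" f] \<open>finite V\<close> by auto
  then have S: "S \<subseteq> V" and min: "f S \<le> f T" if "T \<subseteq> V" for T
    using that by (auto simp: is_arg_min_linorder)
  have "finite S"
    using S[of "{}"] \<open>finite V\<close> finite_subset by auto
  show ?thesis
  proof (rule that)
    show "S \<subseteq> V" using S[of "{}"] by simp
    have "f S < 0"
      using min[of V] t by (simp add: f_def E_def)
    then show "S \<noteq> {}" by (auto simp: f_def E_def)
    fix v assume v: "v \<in> S"
    let ?N = "{y \<in> S. adj v y}"
    have "E S \<subseteq> E (S - {v}) \<union> (Pair v ` ?N \<union> (\<lambda>y. (y, v)) ` ?N)"
    proof
      fix p assume "p \<in> E S"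
      then obtain x y where p: "p = (x, y)" "x \<in> S" "y \<in> S" "adj x y"
        unfolding E_def by blast
      moreover have "adj y x" using p(4) by (rule sym)
      ultimately show "p \<in> E (S - {v}) \<union> (Pair v ` ?N \<union> (\<lambda>y. (y, v)) ` ?N)"
        unfolding E_def by (cases "x = v"; cases "y = v") auto
    qed
    then have "card (E S) \<le> card (E (S - {v}) \<union> (Pair v ` ?N \<union> (\<lambda>y. (y, v)) ` ?N))"
      using \<open>finite S\<close> fin_E by (intro card_mono) auto
    also have "\<dots> \<le> card (E (S - {v})) + (card ?N + card ?N)"
      using \<open>finite S\<close>
      by (intro order.trans[OF card_Un_le] add_mono card_image_le order.refl) auto
    finally have "real (card (E S)) \<le> real (card (E (S - {v}))) + 2 * real (card ?N)"
      by linarith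
    moreover have "f S \<le> f (S - {v})"
      using S[of "{}"] by (intro min) auto
    moreover have "t * real (card S) = t * real (card (S - {v})) + t"
      unfolding card.remove[OF \<open>finite S\<close> v] by (simp only: of_nat_Suc distrib_left mult_1_right add.commute)
    ultimately show "t / 2 \<le> real (card ?N)"
      unfolding f_def by linarith
  qed
qed

text \<open>Jensen for the \<open>r\<close>-th power: Bernoulli's inequality supplies the tangent
  line at \<open>Y / card A\<close>, and since the total is at least \<open>Y\<close>, the linear
  terms have a nonnegative sum.\<close>

lemma power_mean_lower_bound:
  fixes y :: "'a \<Rightarrow> real"
  assumes "finite A" "A \<noteq> {}" "r > 0" "Y \<ge> 0" "\<And>a. a \<in> A \<Longrightarrow> y a \<ge> 0" "Y \<le> (\<Sum>a\<in>A. y a)"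
  shows "real (card A) * (Y / real (card A)) ^ r \<le> (\<Sum>a\<in>A. y a ^ r)"
proof (cases "Y = 0")
  case True
  then show ?thesis using assms by (simp add: sum_nonneg zero_power)
next
  case False
  define c where "c = real (card A)"
  define m where "m = Y / c"
  have "c > 0" using assms by (simp add: c_def card_gt_0_iff)
  then have "m > 0" using False assms by (simp add: m_def)
  have "m ^ r * (1 + real r * (y a / m - 1)) \<le> y a ^ r" if "a \<in> A" for a
  proof -
    have "1 + real r * (y a / m - 1) \<le> (1 + (y a / m - 1)) ^ r"
      using assms(5)[OF that] \<open>m > 0\<close> by (intro Bernoulli_inequality) auto
    then have "m ^ r * (1 + real r * (y a / m - 1)) \<le> m ^ r * (y a / m) ^ r"
      using \<open>m > 0\<close> by (intro mult_left_mono) auto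
    then show ?thesis
      using \<open>m > 0\<close> by (simp add: power_divide)
  qed
  then have "(\<Sum>a\<in>A. m ^ r * (1 + real r * (y a / m - 1))) \<le> (\<Sum>a\<in>A. y a ^ r)"
    by (rule sum_mono)
  also have "(\<Sum>a\<in>A. m ^ r * (1 + real r * (y a / m - 1)))
      = m ^ r * (c + real r * ((\<Sum>a\<in>A. y a) / m - c))"
    by (simp add: sum_distrib_left[symmetric] sum.distrib sum_subtractf sum_divide_distrib c_def)
  finally have *: "m ^ r * (c + real r * ((\<Sum>a\<in>A. y a) / m - c)) \<le> (\<Sum>a\<in>A. y a ^ r)" .
  have "c \<le> (\<Sum>a\<in>A. y a) / m"
    using \<open>c > 0\<close> \<open>m > 0\<close> assms(6) by (subst pos_le_divide_eq) (simp_all add: m_def)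
  then have "m ^ r * c \<le> m ^ r * (c + real r * ((\<Sum>a\<in>A. y a) / m - c))"
    using \<open>m > 0\<close> by (intro mult_left_mono) auto
  then show ?thesis
    using * by (simp add: c_def m_def mult.commute)
qed

text \<open>For \<open>P\<close> a colour class and \<open>l = r\<close>, such a list encodes an
  edge of the energy graph: its two projections are the end tuples, both injective.\<close>

definition pair_tuples :: "('a \<times> 'b) set \<Rightarrow> nat \<Rightarrow> ('a \<times> 'b) list set" where
  "pair_tuples P l = {ps. length ps = l \<and> set ps \<subseteq> P \<and> distinct (map fst ps) \<and> distinct (map snd ps)}"

lemma finite_pair_tuples: "finite P \<Longrightarrow> finite (pair_tuples P l)"
  unfolding pair_tuples_def
  by (rule finite_subset[OF _ finite_lists_length_eq[of P l]]) auto

text \<open>Greedy choice: each of the fewer than \<open>l\<close> pairs already chosen forbids at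
  most \<open>2 * D\<close> further ones. Using \<open>l\<close> at every stage keeps the base of
  the power fixed during the induction.\<close>

lemma card_pair_tuples_ge:
  assumes "finite P"
    and fst: "\<And>u. card {p \<in> P. fst p = u} \<le> D" and snd: "\<And>v. card {p \<in> P. snd p = v} \<le> D"
  shows "(card P - 2 * D * l) ^ l \<le> card (pair_tuples P l)"
proof -
  have "(card P - 2 * D * l) ^ i \<le> card (pair_tuples P i)" if "i \<le> l" for i
    using that
  proof (induction i)
    case 0
    have "pair_tuples P 0 = {[]}" by (auto simp: pair_tuples_def)
    then show ?case by simp
  next
    case (Suc i)
    define ext where "ext = (\<lambda>ps. P - ((\<Union>q\<in>set ps. {p \<in> P. fst p = fst q}) \<union> (\<Union>q\<in>set ps. {p \<in> P. snd p = snd q})))"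
    have ext: "card P - 2 * D * l \<le> card (ext ps)" if "ps \<in> pair_tuples P i" for ps
    proof -
      have "card (set ps) \<le> l"
        using that Suc.prems card_length[of ps] by (auto simp: pair_tuples_def)
      have "card (\<Union>q\<in>set ps. {p \<in> P. fst p = fst q}) \<le> (\<Sum>q\<in>set ps. D)"
        by (intro order.trans[OF card_UN_le] sum_mono fst) auto
      moreover have "card (\<Union>q\<in>set ps. {p \<in> P. snd p = snd q}) \<le> (\<Sum>q\<in>set ps. D)"
        by (intro order.trans[OF card_UN_le] sum_mono snd) auto
      moreover have "(\<Sum>q\<in>set ps. D) \<le> D * l"
        using \<open>card (set ps) \<le> l\<close> by (simp add: mult.commute[of _ D])
      ultimately have "card ((\<Union>q\<in>set ps. {p \<in> P. fst p = fst q}) \<union> (\<Union>q\<in>set ps. {p \<in> P. snd p = snd q}))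
          \<le> 2 * D * l"
        by (intro order.trans[OF card_Un_le]) linarith
      then show ?thesis
        unfolding ext_def using \<open>finite P\<close>
        by (intro order.trans[OF _ diff_card_le_card_Diff]) auto
    qed
    have "(card P - 2 * D * l) ^ Suc i = (card P - 2 * D * l) ^ i * (card P - 2 * D * l)"
      by simp
    also have "\<dots> \<le> card (pair_tuples P i) * (card P - 2 * D * l)"
      using Suc by (intro mult_right_mono) auto
    also have "\<dots> \<le> (\<Sum>ps\<in>pair_tuples P i. card (ext ps))"
      using sum_mono[OF ext] by simp
    also have "\<dots> = card (Sigma (pair_tuples P i) ext)"
      using \<open>finite P\<close> finite_pair_tuples by (subst card_SigmaI) (auto simp: ext_def)
    also have "\<dots> = card ((\<lambda>(ps, p). p # ps) ` Sigma (pair_tuples P i) ext)"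
      by (subst card_image) (auto simp: inj_on_def)
    also have "\<dots> \<le> card (pair_tuples P (Suc i))"
      using \<open>finite P\<close> finite_pair_tuples
      by (intro card_mono) (auto simp: pair_tuples_def ext_def)
    finally show ?case .
  qed
  then show ?thesis by simp
qed

subsection \<open>The energy graph of a colouring\<close>

locale colouring =
  fixes n c r D :: nat and col :: "nat set \<Rightarrow> nat"
  assumes col_less: "u < n \<Longrightarrow> v < n \<Longrightarrow> u \<noteq> v \<Longrightarrow> col {u, v} < c"
    and colour_degree: "card {u. u < n \<and> v < n \<and> u \<noteq> v \<and> col {u, v} = a} \<le> D"
    and r_pos: "r > 0"
begin

definition nbr :: "nat \<Rightarrow> nat \<Rightarrow> nat set" where
  "nbr v a = {u. u < n \<and> v < n \<and> u \<noteq> v \<and> col {u, v} = a}"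

definition tuples :: "(nat \<Rightarrow> nat) set" where
  "tuples = {x \<in> {..<r} \<rightarrow>\<^sub>E {..<n}. inj_on x {..<r}}"

definition energy_adj :: "(nat \<Rightarrow> nat) \<Rightarrow> (nat \<Rightarrow> nat) \<Rightarrow> bool" where
  "energy_adj x y \<longleftrightarrow> (\<exists>a. \<forall>i<r. y i \<in> nbr (x i) a)"

text \<open>The conflict relation for the closed walks. A vertex may be shared at different
  coordinates. As \<open>r > 0\<close>, a tuple meets itself, so a walk without conflicts repeats no
  tuple.\<close>

definition meet :: "(nat \<Rightarrow> nat) \<Rightarrow> (nat \<Rightarrow> nat) \<Rightarrow> bool" where
  "meet x y \<longleftrightarrow> x ` {..<r} \<inter> y ` {..<r} \<noteq> {}"

lemma nbr_sym: "u \<in> nbr v a \<Longrightarrow> v \<in> nbr u a"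
  by (auto simp: nbr_def insert_commute)

lemma card_nbr: "card (nbr v a) \<le> D"
  using colour_degree by (simp add: nbr_def)

lemma finite_nbr: "finite (nbr v a)"
  by (simp add: nbr_def)

lemma energy_adj_sym: "energy_adj x y \<Longrightarrow> energy_adj y x"
  unfolding energy_adj_def by (blast intro: nbr_sym)

lemma finite_tuples: "finite tuples"
  unfolding tuples_def by (rule finite_subset[of _ "{..<r} \<rightarrow>\<^sub>E {..<n}"]) (auto intro: finite_PiE)

lemma card_tuples: "card tuples \<le> n ^ r"
proof -
  have "card tuples \<le> card ({..<r} \<rightarrow>\<^sub>E {..<n})"
    unfolding tuples_def by (intro card_mono finite_PiE) auto
  then show ?thesis by (simp add: card_PiE)
qed

text \<open>If \<open>w i = x j\<close>, the colour between \<open>x j\<close> and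
  \<open>y i\<close> is the common colour of the adjacency, so each coordinate of \<open>w\<close>
  has at most \<open>D\<close> values. There are \<open>r\<^sup>2\<close> choices of
  \<open>(i, j)\<close>.\<close>

lemma card_meeting_neighbours:
  "card {w \<in> tuples. energy_adj y w \<and> meet w x} \<le> r\<^sup>2 * D ^ r"
proof -
  define B where "B = (\<lambda>(i, j). \<Pi>\<^sub>E p\<in>{..<r}. nbr (y p) (col {x j, y i}))"
  have "{w \<in> tuples. energy_adj y w \<and> meet w x} \<subseteq> (\<Union>q\<in>{..<r}\<times>{..<r}. B q)"
  proof
    fix w assume "w \<in> {w \<in> tuples. energy_adj y w \<and> meet w x}"
    then obtain a i j where w: "w \<in> {..<r} \<rightarrow>\<^sub>E {..<n}" and a: "\<forall>i<r. w i \<in> nbr (y i) a"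
      and ij: "i < r" "j < r" "w i = x j"
      by (auto simp: tuples_def energy_adj_def meet_def)
    then have "col {x j, y i} = a"
      by (metis (mono_tags, lifting) mem_Collect_eq nbr_def)
    then have "w \<in> B (i, j)"
      using w a by (auto simp: B_def PiE_iff)
    then show "w \<in> (\<Union>q\<in>{..<r}\<times>{..<r}. B q)"
      using ij by blast
  qed
  then have "card {w \<in> tuples. energy_adj y w \<and> meet w x} \<le> card (\<Union>q\<in>{..<r}\<times>{..<r}. B q)"
    by (intro card_mono) (auto simp: B_def intro!: finite_PiE finite_nbr)
  also have "\<dots> \<le> (\<Sum>q\<in>{..<r}\<times>{..<r}. card (B q))"
    by (intro card_UN_le) auto
  also have "\<dots> \<le> (\<Sum>q\<in>{..<r}\<times>{..<r}. D ^ r)"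
  proof (intro sum_mono)
    fix q
    have "card (B q) = (\<Prod>p<r. card (nbr (y p) (col {x (snd q), y (fst q)})))"
      by (simp add: B_def case_prod_unfold card_PiE)
    also have "\<dots> \<le> (\<Prod>p<r. D)"
      by (intro prod_mono) (simp add: card_nbr)
    finally show "card (B q) \<le> D ^ r" by simp
  qed
  also have "\<dots> = r\<^sup>2 * D ^ r"
    by (simp add: power2_eq_square)
  finally show ?thesis .
qed

definition colour_class :: "nat \<Rightarrow> (nat \<times> nat) set" where
  "colour_class a = {(u, v). v \<in> nbr u a}"

lemma finite_colour_class: "finite (colour_class a)"
  by (rule finite_subset[of _ "{..<n} \<times> {..<n}"]) (auto simp: colour_class_def nbr_def)

lemma sum_card_colour_class: "(\<Sum>a<c. card (colour_class a)) = n * n - n"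
proof -
  have eq: "(\<Union>a<c. colour_class a) = {..<n} \<times> {..<n} - (\<lambda>u. (u, u)) ` {..<n}"
    using col_less by (fastforce simp: colour_class_def nbr_def)
  have "(\<Sum>a<c. card (colour_class a)) = card (\<Union>a<c. colour_class a)"
    by (subst card_UN_disjoint) (auto simp: finite_colour_class, auto simp: colour_class_def nbr_def)
  also have "\<dots> = n * n - n"
    unfolding eq by (subst card_Diff_subset) (auto simp: card_image inj_on_def)
  finally show ?thesis .
qed

lemma card_pair_tuples_colour_class:
  "(card (colour_class a) - 2 * D * r) ^ r \<le> card (pair_tuples (colour_class a) r)"
proof (rule card_pair_tuples_ge[OF finite_colour_class])
  fix u
  have "{p \<in> colour_class a. fst p = u} = Pair u ` nbr u a"
    by (auto simp: colour_class_def)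
  then show "card {p \<in> colour_class a. fst p = u} \<le> D"
    using card_nbr by (simp add: card_image inj_on_def)
  have "{p \<in> colour_class a. snd p = u} = (\<lambda>v. (v, u)) ` nbr u a"
    using nbr_sym by (auto simp: colour_class_def)
  then show "card {p \<in> colour_class a. snd p = u} \<le> D"
    using card_nbr by (simp add: card_image inj_on_def)
qed

text \<open>A colour and a list of \<open>r\<close> pairs of that colour project to two adjacent
  tuples. As \<open>r > 0\<close>, the first pair determines the colour, so no adjacency is counted
  twice.\<close>

lemma energy_ge:
  "(\<Sum>a<c. (card (colour_class a) - 2 * D * r) ^ r)
    \<le> card {(x, y). x \<in> tuples \<and> y \<in> tuples \<and> energy_adj x y}" (is "_ \<le> card ?E")
proof -
  define T where "T = Sigma {..<c} (\<lambda>a. pair_tuples (colour_class a) r)"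
  define h :: "(nat \<times> nat \<Rightarrow> nat) \<Rightarrow> (nat \<times> nat) list \<Rightarrow> nat \<Rightarrow> nat"
    where "h = (\<lambda>f ps. restrict (\<lambda>i. f (ps ! i)) {..<r})"
  define g where "g = (\<lambda>(a::nat, ps). (h fst ps, h snd ps))"
  have tuples: "h f ps \<in> tuples"
    if "length ps = r" "distinct (map f ps)" "\<And>p. p \<in> set ps \<Longrightarrow> f p < n" for f ps
  proof -
    have "inj_on (h f ps) {..<r}"
      using that(1,2) by (auto simp: inj_on_def h_def distinct_conv_nth)
    then show ?thesis
      using that by (auto simp: tuples_def h_def)
  qed
  have sub: "g ` T \<subseteq> ?E"
  proof safe
    fix x y a ps assume "(x, y) = g (a, ps)" and "(a, ps) \<in> T"
    then have xy: "x = h fst ps" "y = h snd ps" and ps: "length ps = r" "set ps \<subseteq> colour_class a"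
      "distinct (map fst ps)" "distinct (map snd ps)"
      by (auto simp: g_def T_def pair_tuples_def)
    show "x \<in> tuples" "y \<in> tuples"
      unfolding xy by (rule tuples; use ps in \<open>force simp: colour_class_def nbr_def\<close>)+
    have "snd (ps ! i) \<in> nbr (fst (ps ! i)) a" if "i < r" for i
    proof -
      have "ps ! i \<in> colour_class a" using ps that nth_mem by blast
      then show ?thesis by (auto simp: colour_class_def)
    qed
    then show "energy_adj x y"
      by (auto simp: energy_adj_def xy h_def)
  qed
  have inj: "inj_on g T"
  proof (rule inj_onI)
    fix p q assume "p \<in> T" "q \<in> T" and eq: "g p = g q"
    obtain a ps b qs where pq: "p = (a, ps)" "q = (b, qs)" by fastforce
    have ps: "length ps = r" "set ps \<subseteq> colour_class a" and qs: "length qs = r" "set qs \<subseteq> colour_class b"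
      using \<open>p \<in> T\<close> \<open>q \<in> T\<close> by (auto simp: pq T_def pair_tuples_def)
    have "ps ! i = qs ! i" if "i < r" for i
    proof -
      have "h fst ps i = h fst qs i" "h snd ps i = h snd qs i"
        using eq by (auto simp: g_def pq)
      then show ?thesis
        using that by (simp add: h_def prod_eq_iff)
    qed
    then have "ps = qs"
      using ps qs by (intro nth_equalityI) auto
    have "ps ! 0 \<in> colour_class a \<inter> colour_class b"
      using ps qs r_pos \<open>ps = qs\<close> nth_mem by blast
    then have "a = b"
      by (auto simp: colour_class_def nbr_def)
    then show "p = q" using \<open>ps = qs\<close> pq by simp
  qed
  have "(\<Sum>a<c. (card (colour_class a) - 2 * D * r) ^ r) \<le> (\<Sum>a<c. card (pair_tuples (colour_class a) r))"
    by (intro sum_mono card_pair_tuples_colour_class)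
  also have "\<dots> = card T"
    unfolding T_def by (simp add: card_SigmaI finite_pair_tuples finite_colour_class)
  also have "\<dots> = card (g ` T)"
    using inj by (simp add: card_image)
  also have "\<dots> \<le> card ?E"
    using sub by (intro card_mono finite_subset[of ?E "tuples \<times> tuples"]) (auto simp: finite_tuples)
  finally show ?thesis .
qed

text \<open>Power means bound the number of adjacent pairs from below, a subset of large minimum
  degree is selected, and \<open>conflict_free_closed_walk\<close> applies there. The hypothesis
  \<open>many\<close> is its size condition with the degree expressed through \<open>n\<close> and
  \<open>c\<close>.\<close>

lemma good_energy_cycle:
  assumes "k > 0" "n \<ge> 2" and sparse: "8 * real D * real r * real c \<le> real n ^ 2"
    and many: "(4 ^ Suc r * (64 * real k ^ 4 * (real r ^ 2 * real D ^ r)) * real c ^ (r - 1)) ^ k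
      * real n ^ r < (real n ^ r) ^ k"
  obtains x where "\<And>i. i < 2 * k \<Longrightarrow> x i \<in> tuples"
    and "\<And>i. i < 2 * k \<Longrightarrow> energy_adj (x i) (x (Suc i mod (2 * k)))"
    and "\<And>i j. i < 2 * k \<Longrightarrow> j < 2 * k \<Longrightarrow> i \<noteq> j \<Longrightarrow> \<not> meet (x i) (x j)"
proof -
  define E where "E = card {(x, y). x \<in> tuples \<and> y \<in> tuples \<and> energy_adj x y}"
  define s where "s = real r ^ 2 * real D ^ r"
  \<comment> \<open>There are at least \<open>n\<^sup>2 / 2\<close> ordered pairs, and
    \<open>sparse\<close> limits the total greedy loss \<open>2 * D * r * c\<close> to
    \<open>n\<^sup>2 / 4\<close>.\<close>
  define Y where "Y = real n ^ 2 / 4"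
  have "n > 0" using \<open>n \<ge> 2\<close> by simp
  have "c > 0"
    using col_less[of 0 1] \<open>n \<ge> 2\<close> by simp
  have "D > 0"
  proof -
    have "1 \<in> {u. u < n \<and> 0 < n \<and> u \<noteq> 0 \<and> col {u, 0} = col {1, 0}}"
      using \<open>n \<ge> 2\<close> by auto
    then have "0 < card {u. u < n \<and> 0 < n \<and> u \<noteq> 0 \<and> col {u, 0} = col {1, 0}}"
      by (subst card_gt_0_iff) auto
    then show ?thesis using colour_degree[of 0 "col {1, 0}"] by linarith
  qed
  then have "s > 0" using r_pos by (simp add: s_def)
  have "real c * (Y / real c) ^ r \<le> (\<Sum>a<c. real (card (colour_class a) - 2 * D * r) ^ r)"
  proof -
    have "Y \<le> (\<Sum>a<c. real (card (colour_class a)) - real (2 * D * r))"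
    proof -
      have "2 * real n \<le> real n ^ 2"
        using \<open>n \<ge> 2\<close> by (simp add: power2_eq_square)
      moreover have "(\<Sum>a<c. real (card (colour_class a))) = real n ^ 2 - real n"
        using arg_cong[OF sum_card_colour_class, of real] \<open>n > 0\<close>
        by (simp add: of_nat_diff power2_eq_square)
      ultimately show ?thesis
        using sparse by (simp add: sum_subtractf Y_def field_simps)
    qed
    also have "\<dots> \<le> (\<Sum>a<c. real (card (colour_class a) - 2 * D * r))"
      by (intro sum_mono) linarith
    finally show ?thesis
      using power_mean_lower_bound[of "{..<c}" r Y "\<lambda>a. real (card (colour_class a) - 2 * D * r)"]
        \<open>c > 0\<close> r_pos by (auto simp: Y_def)
  qed
  also have "\<dots> \<le> real E"
    using energy_ge unfolding E_def by (simp flip: of_nat_power of_nat_sum)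
  finally have E: "real c * (Y / real c) ^ r \<le> real E" .
  then have "E > 0"
  proof -
    have "0 < real c * (Y / real c) ^ r"
      using \<open>c > 0\<close> \<open>n > 0\<close> by (simp add: Y_def)
    then show ?thesis using E by linarith
  qed
  \<comment> \<open>The factor 2 provides the strict inequality in
    \<open>min_degree_subset\<close>.\<close>
  define t where "t = real E / (2 * real n ^ r)"
  have "t > 0" using \<open>E > 0\<close> \<open>n > 0\<close> by (simp add: t_def)
  have "t * real (card tuples) \<le> t * real (n ^ r)"
    using card_tuples \<open>t > 0\<close> by (intro mult_left_mono of_nat_mono) auto
  also have "\<dots> < real E"
    using \<open>E > 0\<close> \<open>n > 0\<close> by (simp add: t_def)
  finally obtain S where S: "S \<subseteq> tuples" "S \<noteq> {}"
    and deg: "\<And>v. v \<in> S \<Longrightarrow> t / 2 \<le> real (card {y \<in> S. energy_adj v y})"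
    using min_degree_subset[of tuples energy_adj t] finite_tuples energy_adj_sym
    unfolding E_def by blast
  have "finite S" using S finite_tuples finite_subset by blast
  interpret G: min_degree_graph S energy_adj "t / 2"
    using \<open>finite S\<close> S(2) energy_adj_sym \<open>t > 0\<close> deg by unfold_locales auto
  have conf: "real (card {w \<in> S. energy_adj y w \<and> meet w x}) \<le> s" for x y
  proof -
    have "card {w \<in> S. energy_adj y w \<and> meet w x} \<le> card {w \<in> tuples. energy_adj y w \<and> meet w x}"
      using S finite_tuples by (intro card_mono) auto
    also have "\<dots> \<le> r\<^sup>2 * D ^ r" by (rule card_meeting_neighbours)
    finally show ?thesis
      unfolding s_def by (simp flip: of_nat_power of_nat_mult)
  qed
  have "(64 * real k ^ 4 * s) ^ k * real (card S) < (t / 2) ^ k"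
  proof -
    have "card S \<le> n ^ r"
      using card_mono[OF finite_tuples S(1)] card_tuples by linarith
    then have "real (card S) \<le> real n ^ r"
      by (simp flip: of_nat_power)
    \<comment> \<open>Chosen so that \<open>real n ^ r / q\<close> is exactly the power mean bound
      on \<open>E\<close> divided by \<open>4 * real n ^ r\<close>.\<close>
    define q where "q = 4 ^ Suc r * real c ^ (r - 1)"
    have "q > 0" using \<open>c > 0\<close> by (simp add: q_def)
    have c_pow: "real c ^ r = real c ^ (r - 1) * real c"
      using r_pos by (metis Suc_diff_1 power_Suc2)
    have "real n ^ r / q \<le> t / 2"
    proof -
      have "real n ^ r / q = real c * (Y / real c) ^ r / (4 * real n ^ r)"
        using \<open>c > 0\<close> \<open>n > 0\<close>
        by (simp add: q_def Y_def power_divide c_pow power_mult_distrib divide_simps)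
          (simp add: power2_eq_square power_mult_distrib)
      also have "\<dots> \<le> real E / (4 * real n ^ r)"
        using E by (intro divide_right_mono) auto
      finally show ?thesis by (simp add: t_def)
    qed
    then have "(real n ^ r / q) ^ k \<le> (t / 2) ^ k"
      using \<open>q > 0\<close> by (intro power_mono) auto
    moreover have "(64 * real k ^ 4 * s) ^ k * real n ^ r < (real n ^ r / q) ^ k"
    proof -
      have "q ^ k * ((64 * real k ^ 4 * s) ^ k * real n ^ r) < (real n ^ r) ^ k"
        using many by (simp add: q_def s_def power_mult_distrib mult_ac del: power_Suc)
      then show ?thesis
        using \<open>q > 0\<close> by (simp add: power_divide pos_less_divide_eq mult_ac)
    qed
    moreover have "(64 * real k ^ 4 * s) ^ k * real (card S) \<le> (64 * real k ^ 4 * s) ^ k * real n ^ r"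
      using \<open>real (card S) \<le> real n ^ r\<close> \<open>s > 0\<close> by (intro mult_left_mono) auto
    ultimately show ?thesis by linarith
  qed
  then obtain x where "\<And>i. i < 2 * k \<Longrightarrow> x i \<in> S"
    and "\<And>i. i < 2 * k \<Longrightarrow> energy_adj (x i) (x (Suc i mod (2 * k)))"
    and "\<And>i j. i < 2 * k \<Longrightarrow> j < 2 * k \<Longrightarrow> i \<noteq> j \<Longrightarrow> \<not> meet (x i) (x j)"
    using G.conflict_free_closed_walk[of meet s k, OF _ conf \<open>s > 0\<close> \<open>k > 0\<close>]
    by (auto simp: meet_def)
  then show ?thesis using that S by blast
qed

end

subsection \<open>Repeated colours\<close>

lemma card_edges_of:
  assumes "finite S"
  shows "card (edges_of S) = card S choose 2" "finite (edges_of S)"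
proof -
  show "card (edges_of S) = card S choose 2"
    unfolding edges_of_def using n_subsets[OF assms] by simp
  show "finite (edges_of S)"
    unfolding edges_of_def using assms by simp
qed

text \<open>Extend \<open>S\<close> to \<open>p\<close> vertices: each edge outside \<open>F\<close>
  adds at most one colour, so the repetitions within \<open>F\<close> count against the deficit
  \<open>(p choose 2) - q\<close>.\<close>

lemma good_colouring_repetition:
  assumes good: "good_colouring n p q c col" and "p \<le> n"
    and S: "S \<subseteq> {..<n}" "card S \<le> p" and F: "F \<subseteq> edges_of S"
  shows "q + card F \<le> (p choose 2) + card (col ` F)"
proof -
  obtain T where T: "S \<subseteq> T" "T \<subseteq> {..<n}" "card T = p"
    using exists_subset_between[of S p "{..<n}"] S \<open>p \<le> n\<close> by auto
  have "finite T" using T finite_subset by blast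
  have FT: "F \<subseteq> edges_of T" using F T by (auto simp: edges_of_def)
  have fin: "finite (edges_of T)" by (rule card_edges_of(2)) fact
  have "q \<le> card (col ` edges_of T)"
    using good T by (simp add: good_colouring_def)
  also have "col ` edges_of T = col ` F \<union> col ` (edges_of T - F)"
    using FT by blast
  also have "card \<dots> \<le> card (col ` F) + card (col ` (edges_of T - F))"
    by (rule card_Un_le)
  also have "\<dots> \<le> card (col ` F) + card (edges_of T - F)"
    using fin by (simp add: card_image_le)
  also have "card (edges_of T - F) = (p choose 2) - card F"
    using FT fin \<open>finite T\<close> T by (simp add: card_Diff_subset finite_subset card_edges_of)
  moreover have "card F \<le> (p choose 2)"
    using card_mono[OF fin FT] \<open>finite T\<close> T by (simp add: card_edges_of)
  ultimately show ?thesis by linarith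
qed

lemma Suc_mod_Suc_mod_neq:
  assumes "3 \<le> m" "i < m"
  shows "Suc (Suc i mod m) mod m \<noteq> i"
  using assms by (auto simp: mod_Suc mod_if split: if_splits)

text \<open>The colouring tolerates fewer than \<open>D\<close> repetitions. A monochromatic star
  with \<open>D + 1\<close> edges has \<open>D\<close> of them, whence the degree bound of the
  locale. An energy cycle has \<open>2 * k * r\<close> edges in at most \<open>2 * k\<close>
  colours, again at least \<open>D\<close> repetitions, so the size condition \<open>many\<close>
  must fail.\<close>

lemma good_colouring_bound:
  fixes n r k c :: nat
  assumes "r \<ge> 2" "k \<ge> 2" and n: "2 * k * r \<le> n"
    and good: "good_colouring n (2*k*r) ((2*k*r choose 2) - (r-1)*(2*k) + 1) c col"
    and D: "D = (r - 1) * (2 * k)"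
    and sparse: "8 * real D * real r * real c \<le> real n ^ 2"
  shows "(real n ^ r) ^ k
    \<le> (4 ^ Suc r * (64 * real k ^ 4 * (real r ^ 2 * real D ^ r)) * real c ^ (r - 1)) ^ k * real n ^ r"
proof (rule ccontr)
  assume many: "\<not> ?thesis"
  have p: "2 * k * r = D + 2 * k"
    using \<open>r \<ge> 2\<close> unfolding D by (cases r) (auto simp: algebra_simps)
  have repetition: "card F < card (col ` F) + D"
    if "S \<subseteq> {..<n}" "card S \<le> 2 * k * r" "F \<subseteq> edges_of S" for S F
    using good_colouring_repetition[OF good n that] \<open>k \<ge> 2\<close> D by simp
  interpret colouring n c r D col
  proof
    fix u v assume "u < n" "v < n" "u \<noteq> v"
    then have "{u, v} \<in> edges_of {..<n}"
      by (auto simp: edges_of_def)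
    then show "col {u, v} < c"
      using good by (auto simp: good_colouring_def)
  next
    fix v a
    show "card {u. u < n \<and> v < n \<and> u \<noteq> v \<and> col {u, v} = a} \<le> D" (is "card ?N \<le> D")
    proof (rule ccontr)
      assume "\<not> card ?N \<le> D"
      then obtain T where T: "T \<subseteq> ?N" "card T = Suc D"
        using obtain_subset_with_card_n[of "Suc D" ?N] by auto
      then have "T \<noteq> {}" "finite T"
        by (auto intro: card_ge_0_finite)
      define F where "F = (\<lambda>u. {u, v}) ` T"
      have "card F = Suc D"
        unfolding F_def using T by (subst card_image) (auto simp: inj_on_def doubleton_eq_iff)
      moreover have "col ` F \<subseteq> {a}"
        using T by (auto simp: F_def)
      then have "card (col ` F) \<le> 1"
        using card_mono[of "{a}"] by fastforce
      \<comment> \<open>The star has \<open>D + 2\<close> vertices, which fit since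
        \<open>2 * k * r = D + 2 * k\<close>.\<close>
      moreover have "card (insert v T) \<le> 2 * k * r"
        using card_insert_le_m1[of "2 * k * r" T v] T(2) \<open>k \<ge> 2\<close> p by simp
      moreover have "insert v T \<subseteq> {..<n}"
        using T \<open>T \<noteq> {}\<close> by auto
      moreover have "F \<subseteq> edges_of (insert v T)"
        using T by (auto simp: F_def edges_of_def)
      ultimately show False
        using repetition[of "insert v T" F] by linarith
    qed
  next
    show "r > 0" using \<open>r \<ge> 2\<close> by simp
  qed
  have "n \<ge> 2"
    using n p \<open>k \<ge> 2\<close> by linarith
  then obtain x where x: "\<And>i. i < 2 * k \<Longrightarrow> x i \<in> tuples"
    and adj: "\<And>i. i < 2 * k \<Longrightarrow> energy_adj (x i) (x (Suc i mod (2 * k)))"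
    and disj: "\<And>i j. i < 2 * k \<Longrightarrow> j < 2 * k \<Longrightarrow> i \<noteq> j \<Longrightarrow> \<not> meet (x i) (x j)"
    using good_energy_cycle[of k] sparse many \<open>k \<ge> 2\<close> by (auto simp: not_le)
  define next' where "next' = (\<lambda>i. Suc i mod (2 * k))"
  have next_less: "next' i < 2 * k" for i
    using \<open>k \<ge> 2\<close> by (simp add: next'_def)
  \<comment> \<open>Indices of the vertices \<open>z\<close> and the edges \<open>e\<close> spanned
    by the cycle: position in the cycle, then coordinate.\<close>
  define I where "I = {..<2 * k} \<times> {..<r}"
  define z where "z = (\<lambda>(i, j). x i j)"
  define e where "e = (\<lambda>(i, j). {x i j, x (next' i) j})"
  have z_eq: "i = i' \<and> j = j'" if "x i j = x i' j'" "i < 2 * k" "i' < 2 * k" "j < r" "j' < r" for i j i' j'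
  proof -
    have "i = i'"
      using disj[of i i'] that by (auto simp: meet_def)
    then show ?thesis
      using x[of i] that by (auto simp: tuples_def inj_on_def)
  qed
  have z_less: "x i j < n" if "i < 2 * k" "j < r" for i j
    using x[OF that(1)] that(2) by (auto simp: tuples_def)
  obtain a where a: "\<And>i j. i < 2 * k \<Longrightarrow> j < r \<Longrightarrow> x (next' i) j \<in> nbr (x i j) (a i)"
    using adj unfolding energy_adj_def next'_def by metis
  have "inj_on e I"
  proof (rule inj_onI)
    fix p p' assume "p \<in> I" "p' \<in> I" "e p = e p'"
    then obtain i j i' j' where eq: "p = (i, j)" "p' = (i', j')"
      and less: "i < 2 * k" "j < r" "i' < 2 * k" "j' < r"
      and "{x i j, x (next' i) j} = {x i' j', x (next' i') j'}"
      by (auto simp: I_def e_def)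
    \<comment> \<open>Edges that coincide with opposite orientations would close the cycle after two
      steps, but its length is at least 4.\<close>
    then consider "x i j = x i' j'" | "x i j = x (next' i') j'" "x (next' i) j = x i' j'"
      by (auto simp: doubleton_eq_iff)
    then show "p = p'"
    proof cases
      case 1
      then show ?thesis using z_eq less eq by blast
    next
      case 2
      then have "i = next' i'" "next' i = i'"
        using z_eq[OF 2(1)] z_eq[OF 2(2)] less next_less by auto
      then have "Suc (Suc i mod (2 * k)) mod (2 * k) = i"
        by (simp add: next'_def)
      then show ?thesis
        using Suc_mod_Suc_mod_neq[of "2 * k" i] \<open>k \<ge> 2\<close> less by simp
    qed
  qed
  then have "card (e ` I) = 2 * k * r"
    by (simp add: card_image I_def)
  moreover have "card (col ` e ` I) \<le> 2 * k"
  proof -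
    have "col ` e ` I \<subseteq> a ` {..<2 * k}"
      using a by (fastforce simp: I_def e_def nbr_def insert_commute)
    then have "card (col ` e ` I) \<le> card (a ` {..<2 * k})"
      by (intro card_mono) auto
    also have "\<dots> \<le> 2 * k"
      using card_image_le[of "{..<2 * k}" a] by simp
    finally show ?thesis .
  qed
  moreover have "card (z ` I) \<le> 2 * k * r"
    using card_image_le[of I z] by (simp add: I_def)
  moreover have "z ` I \<subseteq> {..<n}"
    using z_less by (auto simp: I_def z_def)
  moreover have "e ` I \<subseteq> edges_of (z ` I)"
  proof
    fix f assume "f \<in> e ` I"
    then obtain i j where f: "f = {x i j, x (next' i) j}" and ij: "i < 2 * k" "j < r"
      by (auto simp: e_def I_def)
    have "x i j \<in> z ` I" "x (next' i) j \<in> z ` I"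
      using ij next_less by (force simp: z_def I_def)+
    moreover have "x i j \<noteq> x (next' i) j"
      using a[OF ij] by (auto simp: nbr_def)
    ultimately show "f \<in> edges_of (z ` I)"
      by (simp add: f edges_of_def)
  qed
  ultimately show False
    using repetition[of "z ` I" "e ` I"] p by linarith
qed

section \<open>Passage to the asymptotic bound\<close>

text \<open>A colouring injective on the edges shows \<open>p choose 2\<close> colours on every
  \<open>p\<close>-set, so \<open>LEAST\<close> ranges over a nonempty set.\<close>

lemma erdos_gyarfas_attained:
  assumes "q \<le> (p choose 2)"
  shows "\<exists>col. good_colouring n p q (erdos_gyarfas n p q) col"
proof -
  obtain N and f :: "nat set \<Rightarrow> nat" where f: "f ` edges_of {..<n} = {i. i < N}" "inj_on f (edges_of {..<n})"
    using finite_imp_inj_to_nat_seg[of "edges_of {..<n}"] card_edges_of(2)[of "{..<n}"] by auto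
  have "good_colouring n p q N f"
    unfolding good_colouring_def
  proof (intro conjI allI impI)
    show "f ` edges_of {..<n} \<subseteq> {..<N}" using f by auto
    fix S assume S: "S \<subseteq> {..<n} \<and> card S = p"
    then have "edges_of S \<subseteq> edges_of {..<n}" "finite S"
      by (auto simp: edges_of_def intro: finite_subset)
    then show "q \<le> card (f ` edges_of S)"
      using f(2) assms S by (simp add: card_image inj_on_subset card_edges_of)
  qed
  then have "\<exists>c col. good_colouring n p q c col" by blast
  then show ?thesis
    unfolding erdos_gyarfas_def by (rule LeastI_ex)
qed

theorem theorem6p1:
  fixes r k :: nat
  assumes "r \<ge> 2" and "k \<ge> 2"
  shows "(\<lambda>n. real (erdos_gyarfas n (2*k*r) ((2*k*r choose 2) - (r-1)*(2*k) + 1)))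
           \<in> \<Omega>(\<lambda>n. real n powr ((real r / (real r - 1)) * ((real k - 1) / real k)))"
proof -
  define D where "D = (r - 1) * (2 * k)"
  define q where "q = (2*k*r choose 2) - (r-1)*(2*k) + 1"
  define \<alpha> where "\<alpha> = (real r / (real r - 1)) * ((real k - 1) / real k)"
  define K where "K = 4 ^ Suc r * (64 * real k ^ 4 * (real r ^ 2 * real D ^ r))"
  \<comment> \<open>One summand for each case below: the first when \<open>c\<close> is small enough
    for \<open>good_colouring_bound\<close>, the second when \<open>c\<close> is at least of order
    \<open>n\<^sup>2\<close>.\<close>
  define L where "L = K powr (1 / (real r - 1)) + 8 * real D * real r"
  have "D > 0" using assms by (simp add: D_def)
  have "K > 0" using assms \<open>D > 0\<close> by (simp add: K_def)
  have "L > 0" using \<open>K > 0\<close> \<open>D > 0\<close> assms by (simp add: L_def add_pos_pos)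
  have "q \<le> (2*k*r choose 2)"
  proof -
    have "2 \<le> 2 * k * r" using assms by simp
    then have "(2*k*r choose 2) \<ge> 1"
      using zero_less_binomial[of 2 "2 * k * r"] by linarith
    moreover have "(r-1)*(2*k) \<ge> 1" using \<open>D > 0\<close> unfolding D_def by linarith
    ultimately show ?thesis unfolding q_def by linarith
  qed
  \<comment> \<open>This makes a quadratic lower bound on \<open>c\<close> sufficient in the second
    case.\<close>
  have \<alpha>: "\<alpha> \<le> 2"
  proof -
    have "real r / (real r - 1) \<le> 2" "(real k - 1) / real k \<le> 1"
      using assms by (auto simp: divide_simps)
    then show ?thesis
      unfolding \<alpha>_def using assms mult_mono[of "real r / (real r - 1)" 2 "(real k - 1) / real k" 1] by simp
  qed
  have bound: "real n powr \<alpha> \<le> L * real (erdos_gyarfas n (2*k*r) q)" if n: "2 * k * r \<le> n" for n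
  proof -
    define c where "c = erdos_gyarfas n (2*k*r) q"
    obtain col where good: "good_colouring n (2*k*r) q c col"
      using erdos_gyarfas_attained[OF \<open>q \<le> _\<close>] unfolding c_def by blast
    have "0 < 2 * k * r" using assms by simp
    then have "n \<ge> 1" using n by linarith
    show ?thesis
    proof (cases "8 * real D * real r * real c \<le> real n ^ 2")
      case True
      have main: "(real n ^ r) ^ k \<le> (K * real c ^ (r - 1)) ^ k * real n ^ r"
        using good_colouring_bound[OF assms n good[unfolded q_def] D_def True] by (simp add: K_def)
      have "c > 0"
      proof (rule ccontr)
        assume "\<not> c > 0"
        then have "(real n ^ r) ^ k \<le> 0"
          using main assms by (simp add: zero_power)
        moreover have "0 < (real n ^ r) ^ k"
          using \<open>n \<ge> 1\<close> by (intro zero_less_power) simp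
        ultimately show False by linarith
      qed
      \<comment> \<open>The power \<open>\<beta>\<close> turns the exponent of \<open>c\<close> into
        1 and that of \<open>n\<close> into \<open>\<alpha>\<close>.\<close>
      define \<beta> where "\<beta> = 1 / ((real r - 1) * real k)"
      have "\<beta> > 0" using assms by (simp add: \<beta>_def)
      have "real n powr (real r * real k) \<le> K powr real k * real c powr ((real r - 1) * real k) * real n powr real r"
        using main \<open>n \<ge> 1\<close> \<open>c > 0\<close> \<open>K > 0\<close> assms
        by (simp add: powr_realpow[symmetric] powr_powr powr_mult of_nat_diff)
      then have "real n powr (real r * real k - real r) \<le> K powr real k * real c powr ((real r - 1) * real k)"
        using \<open>n \<ge> 1\<close> by (simp add: powr_diff divide_le_eq)
      then have "(real n powr (real r * real k - real r)) powr \<beta>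
          \<le> (K powr real k * real c powr ((real r - 1) * real k)) powr \<beta>"
        using \<open>\<beta> > 0\<close> by (intro powr_mono2) auto
      also have "\<dots> = K powr (real k * \<beta>) * real c powr (((real r - 1) * real k) * \<beta>)"
        by (simp add: powr_mult powr_powr)
      also have "real k * \<beta> = 1 / (real r - 1)"
        using assms by (simp add: \<beta>_def)
      also have "((real r - 1) * real k) * \<beta> = 1"
        using assms by (simp add: \<beta>_def)
      also have "(real n powr (real r * real k - real r)) powr \<beta> = real n powr \<alpha>"
        using assms by (simp add: powr_powr \<alpha>_def \<beta>_def algebra_simps)
      finally have "real n powr \<alpha> \<le> K powr (1 / (real r - 1)) * real c"
        using \<open>c > 0\<close> by simp
      also have "\<dots> \<le> L * real c"
        unfolding L_def by (intro mult_right_mono) auto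
      finally show ?thesis by (simp add: c_def)
    next
      case False
      have "real n powr \<alpha> \<le> real n powr 2"
        using \<alpha> \<open>n \<ge> 1\<close> by (intro powr_mono) auto
      also have "\<dots> \<le> 8 * real D * real r * real c"
        using False \<open>n \<ge> 1\<close> by simp
      also have "\<dots> \<le> L * real c"
        unfolding L_def by (intro mult_right_mono) auto
      finally show ?thesis by (simp add: c_def)
    qed
  qed
  have "eventually (\<lambda>n. norm (real (erdos_gyarfas n (2*k*r) q)) \<ge> (1 / L) * norm (real n powr \<alpha>)) sequentially"
    using eventually_ge_at_top[of "2 * k * r"]
    by eventually_elim (use bound \<open>L > 0\<close> in \<open>simp add: field_simps\<close>)
  then show ?thesis
    unfolding q_def[symmetric] \<alpha>_def[symmetric] using \<open>L > 0\<close>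
    by (intro landau_omega.bigI[of "1 / L"]) auto
qed

end
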